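(* Let $g \in C^0([0,\infty))$ and let $\mathcal M \subset \mathbb R^3$ be a closed reference surface. Let $\mathfrak X : \mathcal M \times [0,T] \to \mathbb R^3$ be a (sufficiently smooth) family of parameterizations of the closed oriented surfaces $\mathcal S(t) = \mathfrak X(\mathcal M,t)$, with $\mathfrak X(\cdot,t)$ a bijection between $\mathcal M$ and $\mathcal S(t)$ for each $t\in[0,T]$, which solves the system $$\mathfrak X_{tt}\circ \mathfrak X^{-1} = g\bigl(|\mathfrak X_t|^2\circ \mathfrak X^{-1}\bigr)\, H\, \nu_{\mathcal S} - \tfrac12 \nabla_{\mathcal S(t)}\bigl(|\mathfrak X_t|^2\circ \mathfrak X^{-1}\bigr) \quad\text{on } \mathcal S(t)=\mathfrak X(\mathcal M,t),\ t\in[0,T],$$ $$\mathfrak X(\cdot,0)=\mathfrak X_0,\qquad \mathfrak X_t(\cdot,0) = V_0\, \nu_{\mathcal S}\circ \mathfrak X_0 \quad\text{on } \mathcal M,$$ where $\mathfrak X_0:\mathcal M\to\mathbb R^3$ is a parameterization of the initial surface $\mathcal S_0$ and $V_0:\mathcal M\to\mathbb R$ is a given initial normal velocity. Then the family $\mathcal S(t)=\mathfrak X(\mathcal M,t)$ satisfies $$\partial_t^{\square}\, \mathcal V_{\mathcal S} = g(\mathcal V_{\mathcal S}^2)\, H \quad\text{on } \mathcal S(t).$$ Furthermore, $\mathfrak X$ is a normal parameterization, i.e. $$\mathfrak X_t(p,t)\cdot \tau = 0 \qquad \text{for all } \tau\in \mathrm T_{\mathfrak X(p,t)}\mathcal S(t)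 \text{ and all } (p,t)\in \mathcal M\times[0,T].$$
   Context: Here $\nu_{\mathcal S}$ denotes the unit normal of the oriented surface $\mathcal S(t)$ (varying smoothly in $t$), and $\mathcal V_{\mathcal S}$ is the velocity of the family $(\mathcal S(t))_{t\in[0,T]}$ in the direction of $\nu_{\mathcal S}$, i.e. $\mathcal V_{\mathcal S}\circ\mathfrak X = \mathfrak X_t\cdot(\nu_{\mathcal S}\circ\mathfrak X)$. $H$ is the mean curvature of $\mathcal S(t)$ (sum of the principal curvatures) with the sign convention that the unit sphere with outward normal has $H=-2$; equivalently $H\nu_{\mathcal S}=\Delta_{\mathcal S(t)}\,\mathrm{id}$. $\nabla_{\mathcal S(t)} f$ is the tangential (surface) gradient of $f:\mathcal S(t)\to\mathbb R$, and $\mathrm T_z\mathcal S(t)$ is the tangent space to $\mathcal S(t)$ at $z\in\mathcal S(t)$. For fixed $t$, $\mathfrak X^{-1}$ denotes the inverse of $\mathfrak X(\cdot,t):\mathcal M\to\mathcal S(t)$. "Parameterization" means that $\mathfrak X(\cdot,t)$ is a smooth immersion, so that for every local parameterization $\phi$ of $\mathcal M$ the partial derivatives of $\mathfrak X(\phi(\cdot),t)$ form a basis of the tangent space of $\mathcal S(t)$. The normal time derivative $\partial_t^{\square} f$ of a function $f$ defined on $\bigcup_{t}\mathcal S(t)\times\{t\}$ is given at $(x_0,t_0)$ with $x_0\in\mathcal S(t_0)$ by $\partial_t^{\square} f(x_0,t_0) = \frac{\mathrm d}{\mathrm dt} f(\gamma(t),t)\big|_{t=t_0}$, where $\gamma$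 is the curve with $\gamma(t)\in\mathcal S(t)$, $\gamma'(t)=\mathcal V_{\mathcal S}(\gamma(t),t)\,\nu_{\mathcal S}(\gamma(t),t)$ and $\gamma(t_0)=x_0$. *)

theory Defs
  imports "HOL-Analysis.Analysis"
begin

section \<open>Functions of class \<open>C\<^sup>k\<close>\<close>

text \<open>Derivatives are taken within \<open>A\<close>, so that \<open>A\<close> may be a product of an open set with a
  compact time interval, one-sided derivatives being meant at the end points. The notion is
  intended for sets on which the derivative within \<open>A\<close> is unique, such as open sets and
  \<open>U \<times> {0..T}\<close> with \<open>U\<close> open and \<open>T > 0\<close>.\<close>

fun Ck_on :: "nat \<Rightarrow> 'a::real_normed_vector set \<Rightarrow> ('a \<Rightarrow> 'b::real_normed_vector) \<Rightarrow> bool" where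
  "Ck_on 0 A f \<longleftrightarrow> continuous_on A f"
| "Ck_on (Suc k) A f \<longleftrightarrow>
     (\<exists>f'. (\<forall>x\<in>A. (f has_derivative f' x) (at x within A)) \<and> (\<forall>v. Ck_on k A (\<lambda>x. f' x v)))"


section \<open>Surfaces in three-dimensional space\<close>

definition local_param ::
    "nat \<Rightarrow> (real^3) set \<Rightarrow> (real^2) set \<Rightarrow> (real^2 \<Rightarrow> real^3) \<Rightarrow> bool" where
  "local_param k M U \<phi> \<longleftrightarrow>
     open U \<and> Ck_on k U \<phi> \<and> (\<forall>u\<in>U. inj (frechet_derivative \<phi> (at u))) \<and>
     openin (top_of_set M) (\<phi> ` U) \<and> (\<exists>\<psi>. homeomorphism U (\<phi> ` U) \<phi> \<psi>)"

definition closed_surface :: "nat \<Rightarrow> (real^3) set \<Rightarrow> bool" where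
  "closed_surface k M \<longleftrightarrow>
     compact M \<and> (\<forall>p\<in>M. \<exists>U \<phi>. local_param k M U \<phi> \<and> p \<in> \<phi> ` U)"

definition tangent_space :: "(real^3) set \<Rightarrow> real^3 \<Rightarrow> (real^3) set" where
  "tangent_space S z =
     {v. \<exists>\<gamma> \<epsilon>. \<epsilon> > 0 \<and> \<gamma> differentiable_on {-\<epsilon><..<\<epsilon>} \<and> \<gamma> ` {-\<epsilon><..<\<epsilon>} \<subseteq> S \<and>
             \<gamma> 0 = z \<and> (\<gamma> has_vector_derivative v) (at 0)}"

text \<open>An injective immersion of class \<open>C\<^sup>k\<close> of \<open>M\<close> onto \<open>S\<close>: injectivity of the derivative of
  \<open>x \<circ> \<phi>\<close> says that its two partial derivatives are linearly independent.\<close>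

definition parameterization ::
    "nat \<Rightarrow> (real^3) set \<Rightarrow> (real^3 \<Rightarrow> real^3) \<Rightarrow> (real^3) set \<Rightarrow> bool" where
  "parameterization k M x S \<longleftrightarrow>
     bij_betw x M S \<and>
     (\<forall>U \<phi>. local_param k M U \<phi> \<longrightarrow>
        Ck_on k U (x \<circ> \<phi>) \<and> (\<forall>u\<in>U. inj (frechet_derivative (x \<circ> \<phi>) (at u))))"

definition unit_normal_field :: "(real^3) set \<Rightarrow> (real^3 \<Rightarrow> real^3) \<Rightarrow> bool" where
  "unit_normal_field S \<nu> \<longleftrightarrow>
     (\<forall>z\<in>S. norm (\<nu> z) = 1 \<and> (\<forall>\<tau>\<in>tangent_space S z. \<nu> z \<bullet> \<tau> = 0))"

text \<open>A derivative of a function on \<open>S\<close> at \<open>z\<close> within \<open>S\<close> is determined exactly on the tangent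
  space; its values on normal vectors are arbitrary. Demanding that the representing vector be
  tangential therefore singles out the surface gradient.\<close>

definition surface_gradient :: "(real^3) set \<Rightarrow> (real^3 \<Rightarrow> real) \<Rightarrow> real^3 \<Rightarrow> real^3" where
  "surface_gradient S f z =
     (THE G. G \<in> tangent_space S z \<and> (f has_derivative (\<lambda>h. G \<bullet> h)) (at z within S))"

text \<open>The principal curvatures are the eigenvalues, with multiplicity, of the Weingarten map
  \<open>-d\<nu>\<close> on the tangent space. The minus sign makes both of them \<open>-1\<close> on the unit sphere with
  outward normal.\<close>

definition principal_curvatures ::
    "(real^3) set \<Rightarrow> (real^3 \<Rightarrow> real^3) \<Rightarrow> real^3 \<Rightarrow> real \<Rightarrow> real \<Rightarrow> bool" where
  "principal_curvatures S \<nu> z \<kappa>1 \<kappa>2 \<longleftrightarrow>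
     (\<exists>d\<nu> e1 e2. (\<nu> has_derivative d\<nu>) (at z within S) \<and>
        e1 \<in> tangent_space S z \<and> e2 \<in> tangent_space S z \<and>
        norm e1 = 1 \<and> norm e2 = 1 \<and> e1 \<bullet> e2 = 0 \<and>
        - d\<nu> e1 = \<kappa>1 *\<^sub>R e1 \<and> - d\<nu> e2 = \<kappa>2 *\<^sub>R e2)"

definition mean_curvature :: "(real^3) set \<Rightarrow> (real^3 \<Rightarrow> real^3) \<Rightarrow> real^3 \<Rightarrow> real" where
  "mean_curvature S \<nu> z = (THE H. \<exists>\<kappa>1 \<kappa>2. principal_curvatures S \<nu> z \<kappa>1 \<kappa>2 \<and> H = \<kappa>1 + \<kappa>2)"


section \<open>Evolving surfaces\<close>

definition Ck_family :: "nat \<Rightarrow> (real^3) set \<Rightarrow> real \<Rightarrow> (real^3 \<Rightarrow> real \<Rightarrow> real^3) \<Rightarrow> bool" where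
  "Ck_family k M T f \<longleftrightarrow>
     (\<forall>U \<phi>. local_param k M U \<phi> \<longrightarrow> Ck_on k (U \<times> {0..T}) (\<lambda>(u, t). f (\<phi> u) t))"

definition time_deriv :: "real \<Rightarrow> (real^3 \<Rightarrow> real \<Rightarrow> real^3) \<Rightarrow> real^3 \<Rightarrow> real \<Rightarrow> real^3" where
  "time_deriv T f p t = vector_derivative (f p) (at t within {0..T})"

text \<open>The function \<open>f(\<cdot>, t) \<circ> X(\<cdot>, t)\<^sup>-\<^sup>1\<close> on the surface \<open>X(M, t)\<close>, for \<open>f\<close> defined on
  \<open>M \<times> [0, T]\<close>.\<close>

definition on_surface ::
    "(real^3) set \<Rightarrow> (real^3 \<Rightarrow> real \<Rightarrow> real^3) \<Rightarrow> (real^3 \<Rightarrow> real \<Rightarrow> 'b) \<Rightarrow>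
     real^3 \<Rightarrow> real \<Rightarrow> 'b" where
  "on_surface M X f z t = f (inv_into M (\<lambda>p. X p t) z) t"

definition normal_velocity ::
    "(real^3) set \<Rightarrow> real \<Rightarrow> (real^3 \<Rightarrow> real \<Rightarrow> real^3) \<Rightarrow> (real^3 \<Rightarrow> real \<Rightarrow> real^3) \<Rightarrow>
     real^3 \<Rightarrow> real \<Rightarrow> real" where
  "normal_velocity M T X \<nu> z t = on_surface M X (time_deriv T X) z t \<bullet> \<nu> z t"

definition normal_curve ::
    "real \<Rightarrow> (real \<Rightarrow> (real^3) set) \<Rightarrow> (real^3 \<Rightarrow> real \<Rightarrow> real) \<Rightarrow> (real^3 \<Rightarrow> real \<Rightarrow> real^3) \<Rightarrow>
     real^3 \<Rightarrow> real \<Rightarrow> (real \<Rightarrow> real^3) \<Rightarrow> bool" where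
  "normal_curve T S V \<nu> x0 t0 \<gamma> \<longleftrightarrow>
     (\<forall>t\<in>{0..T}. \<gamma> t \<in> S t \<and>
        (\<gamma> has_vector_derivative V (\<gamma> t) t *\<^sub>R \<nu> (\<gamma> t) t) (at t within {0..T})) \<and>
     \<gamma> t0 = x0"

text \<open>That \<open>f\<close> has normal time derivative \<open>D\<close> at \<open>(x0, t0)\<close> includes the existence of a normal
  curve through \<open>x0\<close> and that the value \<open>D\<close> does not depend on its choice.\<close>

definition has_normal_time_derivative ::
    "real \<Rightarrow> (real \<Rightarrow> (real^3) set) \<Rightarrow> (real^3 \<Rightarrow> real \<Rightarrow> real) \<Rightarrow> (real^3 \<Rightarrow> real \<Rightarrow> real^3) \<Rightarrow>
     (real^3 \<Rightarrow> real \<Rightarrow> real) \<Rightarrow> real \<Rightarrow> real^3 \<Rightarrow> real \<Rightarrow> bool" where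
  "has_normal_time_derivative T S V \<nu> f D x0 t0 \<longleftrightarrow>
     (\<exists>\<gamma>. normal_curve T S V \<nu> x0 t0 \<gamma>) \<and>
     (\<forall>\<gamma>. normal_curve T S V \<nu> x0 t0 \<gamma> \<longrightarrow>
        ((\<lambda>t. f (\<gamma> t) t) has_real_derivative D) (at t0 within {0..T}))"

end

theory Submission
  imports Defs
begin

text \<open>
  Write \<open>V = X\<^sub>t\<close> and let \<open>e\<close> be a direction in a chart \<open>\<phi>\<close> of \<open>M\<close>. The gradient term in the
  system is there to keep \<open>V\<close> normal: since mixed partial derivatives commute,
  \<open>(V \<bullet> \<partial>\<^sub>e X)\<^sub>t = X\<^sub>t\<^sub>t \<bullet> \<partial>\<^sub>e X + V \<bullet> \<partial>\<^sub>e V\<close>. The curvature term of \<open>X\<^sub>t\<^sub>t\<close> is normal and so does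
  not contribute, and the gradient term contributes \<open>-\<onehalf> \<partial>\<^sub>e \<bar>V\<bar>\<^sup>2 = - V \<bullet> \<partial>\<^sub>e V\<close>. Hence
  \<open>V \<bullet> \<partial>\<^sub>e X\<close> is constant in time, and it vanishes initially
  (\<open>velocity_normal_if_acceleration\<close>).

  Consequently \<open>V = v \<nu>\<close> with \<open>v\<close> the normal velocity, and the trajectories \<open>t \<mapsto> X(p, t)\<close> are
  normal curves. They are the only ones (\<open>normal_curve_is_trajectory\<close>), so the normal time
  derivative of \<open>v\<close> is the ordinary derivative of \<open>V \<bullet> \<nu>\<close> along a trajectory, which is
  \<open>X\<^sub>t\<^sub>t \<bullet> \<nu> + v \<nu> \<bullet> \<nu>\<^sub>t\<close>. Here \<open>\<nu> \<bullet> \<nu>\<^sub>t = 0\<close> because \<open>\<nu>\<close> has length one, and the gradient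
  term of \<open>X\<^sub>t\<^sub>t\<close> is tangential, which leaves \<open>g(v\<^sup>2) H\<close>.

  Two points need work. The surface gradient is determined by derivatives within the surface,
  which requires that the inverse of \<open>X(\<cdot>, t) \<circ> \<phi>\<close> be differentiable on the image; this and the
  uniqueness of normal curves both come from \<open>chart_inverse_has_derivative\<close>, applied to one
  time slice and to the space-time map \<open>(p, t) \<mapsto> (X(p, t), t)\<close> respectively. Moreover, the
  tangent space is defined by curves; that it is the plane spanned by the partial derivatives
  follows by counting dimensions, because it contains this plane and is contained in the
  orthogonal complement of the unit normal (\<open>tangent_space_eq\<close>).
\<close>

section \<open>Partial derivatives on a product with a time interval\<close>

lemma Ck_on_SucD: "Ck_on (Suc k) A f \<Longrightarrow> Ck_on k A f"
proof (induction k arbitrary: f)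
  case 0
  then show ?case
    using has_derivative_continuous_on by fastforce
next
  case (Suc k)
  then show ?case unfolding Ck_on.simps(2)[of "Suc k"] Ck_on.simps(2)[of k A f] by blast
qed

lemma local_param_SucD: "local_param (Suc k) M U \<phi> \<Longrightarrow> local_param k M U \<phi>"
  using Ck_on_SucD unfolding local_param_def by blast

lemma has_derivative_slices:
  assumes "((\<lambda>(u, t). Y u t) has_derivative D) (at (u, t) within U \<times> J)" "open U" "u \<in> U" "t \<in> J"
  shows "((\<lambda>u. Y u t) has_derivative (\<lambda>v. D (v, 0))) (at u)"
    and "(Y u has_vector_derivative D (0, 1)) (at t within J)"
proof -
  have "((\<lambda>(u, t). Y u t) \<circ> (\<lambda>v. (v, t)) has_derivative D \<circ> (\<lambda>v. (v, 0))) (at u within U)"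
  proof (rule diff_chain_within)
    show "((\<lambda>v. (v, t)) has_derivative (\<lambda>v. (v, 0))) (at u within U)"
      by (intro has_derivative_Pair has_derivative_ident has_derivative_const)
    show "((\<lambda>(u, t). Y u t) has_derivative D) (at (u, t) within (\<lambda>v. (v, t)) ` U)"
      by (rule has_derivative_subset[OF assms(1)]) (use \<open>t \<in> J\<close> in auto)
  qed
  then show "((\<lambda>u. Y u t) has_derivative (\<lambda>v. D (v, 0))) (at u)"
    by (simp add: o_def at_within_open[OF \<open>u \<in> U\<close> \<open>open U\<close>])
  have "((\<lambda>(u, t). Y u t) \<circ> (\<lambda>s. (u, s)) has_derivative D \<circ> (\<lambda>s. (0, s))) (at t within J)"
  proof (rule diff_chain_within)
    show "((\<lambda>s. (u, s)) has_derivative (\<lambda>s. (0, s))) (at t within J)"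
      by (intro has_derivative_Pair has_derivative_ident has_derivative_const)
    show "((\<lambda>(u, t). Y u t) has_derivative D) (at (u, t) within (\<lambda>s. (u, s)) ` J)"
      by (rule has_derivative_subset[OF assms(1)]) (use \<open>u \<in> U\<close> in auto)
  qed
  moreover have "D \<circ> (\<lambda>s. (0, s)) = (\<lambda>s. s *\<^sub>R D (0, 1))"
  proof
    show "(D \<circ> (\<lambda>s. (0, s))) s = s *\<^sub>R D (0, 1)" for s
      using linear_scale[OF has_derivative_linear[OF assms(1)], of s "(0, 1)"] by simp
  qed
  ultimately show "(Y u has_vector_derivative D (0, 1)) (at t within J)"
    unfolding has_vector_derivative_def by (simp only: o_def case_prod_conv)
qed

text \<open>Equality of mixed partial derivatives, up to the end points of the time interval:
  differentiate
  \<open>f s r - f s 0 = \<integral>\<^sub>0\<^sup>r f\<^sub>t s\<close> in \<open>s\<close> under the integral sign, then in \<open>r\<close> by the fundamental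
  theorem of calculus.\<close>

lemma mixed_partials_exchange:
  fixes f :: "real \<Rightarrow> real \<Rightarrow> 'b::banach"
  assumes I: "open I" "convex I" "s \<in> I" and t: "t \<in> {0..T}"
    and ft: "\<And>s t. s \<in> I \<Longrightarrow> t \<in> {0..T} \<Longrightarrow> (f s has_vector_derivative ft s t) (at t within {0..T})"
    and fs: "\<And>t. t \<in> {0..T} \<Longrightarrow> ((\<lambda>s. f s t) has_vector_derivative fs t) (at s)"
    and fts: "\<And>s t. s \<in> I \<Longrightarrow> t \<in> {0..T} \<Longrightarrow> ((\<lambda>s. ft s t) has_vector_derivative fts s t) (at s)"
    and cont: "continuous_on (I \<times> {0..T}) (\<lambda>(s, t). fts s t)"
  shows "(fs has_vector_derivative fts s t) (at t within {0..T})"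
proof -
  have fs_eq: "fs r = fs 0 + integral {0..r} (fts s)" if r: "r \<in> {0..T}" for r
  proof -
    have ftc: "(ft x has_integral (f x r - f x 0)) {0..r}" if "x \<in> I" for x
      using r that
      by (intro fundamental_theorem_of_calculus)
        (auto intro!: has_vector_derivative_within_subset[OF ft])
    have leibniz: "((\<lambda>x. integral (cbox 0 r) (ft x)) has_vector_derivative integral (cbox 0 r) (fts s))
        (at s within I)"
    proof (rule leibniz_rule_vector_derivative)
      show "((\<lambda>x. ft x t) has_vector_derivative fts x t) (at x within I)" if "x \<in> I" "t \<in> cbox 0 r" for x t
        using fts[of x t] that r by (simp add: has_vector_derivative_at_within)
      show "ft x integrable_on cbox 0 r" if "x \<in> I" for x
        using ftc[OF that] by (auto simp: integrable_on_def)
      show "continuous_on (I \<times> cbox 0 r) (\<lambda>(s, t). fts s t)"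
        using r by (intro continuous_on_subset[OF cont]) auto
    qed (use I in auto)
    have "((\<lambda>x. f x r - f x 0) has_vector_derivative integral {0..r} (fts s))
        (at s within I)"
      by (rule has_vector_derivative_transform[OF \<open>s \<in> I\<close> _ leibniz[unfolded cbox_interval]])
        (simp add: integral_unique[OF ftc])
    then have "((\<lambda>x. f x r - f x 0) has_vector_derivative integral {0..r} (fts s)) (at s)"
      by (simp only: at_within_open[OF \<open>s \<in> I\<close> \<open>open I\<close>])
    moreover have "((\<lambda>x. f x r - f x 0) has_vector_derivative fs r - fs 0) (at s)"
      using r by (intro has_vector_derivative_diff fs) auto
    ultimately have "integral {0..r} (fts s) = fs r - fs 0"
      by (rule vector_derivative_unique_at)
    then show ?thesis by simp
  qed
  have ivl: "((\<lambda>r. fs 0 + integral {0..r} (fts s)) has_vector_derivative 0 + fts s t) (at t within {0..T})"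
  proof (intro has_vector_derivative_add has_vector_derivative_const integral_has_vector_derivative)
    show "continuous_on {0..T} (fts s)"
      by (rule continuous_on_compose2[OF cont, of "{0..T}" "\<lambda>t. (s, t)", simplified])
        (use I in \<open>auto intro: continuous_on_Pair\<close>)
  qed (use t in auto)
  have "(fs has_vector_derivative 0 + fts s t) (at t within {0..T})"
    by (rule has_vector_derivative_transform[OF t _ ivl]) (fact fs_eq)
  then show ?thesis by simp
qed

text \<open>What regularity \<open>C\<^sup>2\<close> in space-time is used for: the time derivative is differentiable in
  space, and its spatial derivative is also the time derivative of the spatial derivative.\<close>

lemma C2_evolution_partials:
  fixes Y :: "'a::real_normed_vector \<Rightarrow> real \<Rightarrow> 'b::banach"
  assumes U: "open U" and Y: "Ck_on 2 (U \<times> {0..T}) (\<lambda>(u, t). Y u t)"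
  obtains dY Yt dYt where
    "\<And>u t. u \<in> U \<Longrightarrow> t \<in> {0..T} \<Longrightarrow> ((\<lambda>(u, t). Y u t) has_derivative
       (\<lambda>(v, r). dY u t v + r *\<^sub>R Yt u t)) (at (u, t) within U \<times> {0..T})"
    "Ck_on 1 (U \<times> {0..T}) (\<lambda>(u, t). Yt u t)"
    "\<And>u t. u \<in> U \<Longrightarrow> t \<in> {0..T} \<Longrightarrow> ((\<lambda>u. Yt u t) has_derivative dYt u t) (at u)"
    "\<And>u t e. u \<in> U \<Longrightarrow> t \<in> {0..T} \<Longrightarrow>
       ((\<lambda>t. dY u t e) has_vector_derivative dYt u t e) (at t within {0..T})"
proof -
  let ?A = "U \<times> {0..T}"
  have Y2: "Ck_on (Suc (Suc 0)) ?A (\<lambda>(u, t). Y u t)" using Y unfolding numeral_2_eq_2 .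
  then obtain D where D: "\<And>x. x \<in> ?A \<Longrightarrow> ((\<lambda>(u, t). Y u t) has_derivative D x) (at x within ?A)"
    and D1: "\<And>v. Ck_on (Suc 0) ?A (\<lambda>x. D x v)"
    unfolding Ck_on.simps(2)[of "Suc 0"] by blast
  obtain D2 where D2: "\<And>x. x \<in> ?A \<Longrightarrow> ((\<lambda>x. D x (0, 1)) has_derivative D2 x) (at x within ?A)"
    and D2c: "\<And>v. continuous_on ?A (\<lambda>x. D2 x v)"
    using D1[of "(0, 1)"] by auto
  define dY where "dY u t v = D (u, t) (v, 0)" for u t v
  define Yt where "Yt u t = D (u, t) (0, 1)" for u t
  define dYt where "dYt u t v = D2 (u, t) (v, 0)" for u t v
  have Dt: "(Y u has_vector_derivative Yt u t) (at t within {0..T})"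
    and Du: "((\<lambda>u. Y u t) has_derivative dY u t) (at u)" if "u \<in> U" "t \<in> {0..T}" for u t
    using has_derivative_slices[OF D U] that unfolding dY_def[abs_def] Yt_def by auto
  have Dtu: "((\<lambda>u. Yt u t) has_derivative dYt u t) (at u)" if "u \<in> U" "t \<in> {0..T}" for u t
    unfolding dYt_def[abs_def]
    by (rule has_derivative_slices(1)) (use D2[of "(u, t)"] U that in \<open>auto simp: Yt_def split_def\<close>)
  show ?thesis
  proof
    fix u t assume ut: "u \<in> U" "t \<in> {0..T}"
    interpret D: bounded_linear "D (u, t)" using D ut has_derivative_bounded_linear by blast
    have "D (u, t) = (\<lambda>(v, r). dY u t v + r *\<^sub>R Yt u t)"
    proof (rule ext, clarify)
      fix v r
      show "D (u, t) (v, r) = dY u t v + r *\<^sub>R Yt u t"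
        using D.add[of "(v, 0)" "r *\<^sub>R (0, 1)"] D.scaleR[of r "(0, 1)"] by (simp add: dY_def Yt_def)
    qed
    then show "((\<lambda>(u, t). Y u t) has_derivative (\<lambda>(v, r). dY u t v + r *\<^sub>R Yt u t)) (at (u, t) within ?A)"
      using D[of "(u, t)"] ut by simp
    show "((\<lambda>t. dY u t e) has_vector_derivative dYt u t e) (at t within {0..T})" for e
    proof -
      obtain \<rho> where \<rho>: "\<rho> > 0" "ball u \<rho> \<subseteq> U" using U ut openE by blast
      define d where "d = \<rho> / (norm e + 1)"
      have d: "d > 0" "d * norm e < \<rho>"
      proof -
        have pos: "norm e + 1 > 0" by (simp add: add_nonneg_pos)
        then show "d > 0" using \<rho> by (simp add: d_def)
        have "d * norm e < d * (norm e + 1)" using \<open>d > 0\<close> by (intro mult_strict_left_mono) auto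
        also have "\<dots> = \<rho>" using pos by (simp add: d_def)
        finally show "d * norm e < \<rho>" .
      qed
      define I where "I = {-d<..<d}"
      have IU: "u + s *\<^sub>R e \<in> U" if "s \<in> I" for s
      proof -
        have "\<bar>s\<bar> * norm e \<le> d * norm e" using that by (intro mult_right_mono) (auto simp: I_def)
        then show ?thesis using \<rho> d by (intro subsetD[OF \<rho>(2)]) (simp add: dist_norm)
      qed
      have line: "((\<lambda>s. u + s *\<^sub>R e) has_derivative (\<lambda>s. s *\<^sub>R e)) (at s)" for s
        by (auto intro!: derivative_eq_intros)
      have along: "((\<lambda>s. h (u + s *\<^sub>R e)) has_vector_derivative h' e) (at s)"
        if "(h has_derivative h') (at (u + s *\<^sub>R e))" for h :: "'a \<Rightarrow> 'b" and h' s
        using has_derivative_compose[OF line that] linear_scale[OF has_derivative_linear[OF that]]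
        by (simp add: has_vector_derivative_def)
      have "((\<lambda>t. dY u t e) has_vector_derivative dYt (u + 0 *\<^sub>R e) t e) (at t within {0..T})"
      proof (rule mixed_partials_exchange[where I = I and f = "\<lambda>s. Y (u + s *\<^sub>R e)"
            and ft = "\<lambda>s. Yt (u + s *\<^sub>R e)"])
        show "open I" "convex I" "0 \<in> I" using d by (auto simp: I_def)
        show "continuous_on (I \<times> {0..T}) (\<lambda>(s, t). dYt (u + s *\<^sub>R e) t e)"
          unfolding dYt_def split_def
        proof (rule continuous_on_compose2[OF D2c])
          show "continuous_on (I \<times> {0..T}) (\<lambda>x. (u + fst x *\<^sub>R e, snd x))"
            by (intro continuous_intros)
          show "(\<lambda>x. (u + fst x *\<^sub>R e, snd x)) ` (I \<times> {0..T}) \<subseteq> ?A"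
            using IU by auto
        qed
        show "((\<lambda>s. Y (u + s *\<^sub>R e) t) has_vector_derivative dY u t e) (at 0)"
          if "t \<in> {0..T}" for t
          using along[OF Du, of 0 t] that ut by simp
        show "((\<lambda>s. Yt (u + s *\<^sub>R e) t) has_vector_derivative dYt (u + s *\<^sub>R e) t e) (at s)"
          if "s \<in> I" "t \<in> {0..T}" for s t
          using along[OF Dtu] that IU by simp
      qed (use ut IU Dt in auto)
      then show ?thesis by simp
    qed
  next
    show "Ck_on 1 ?A (\<lambda>(u, t). Yt u t)"
      using D1[of "(0, 1)"] by (simp add: Yt_def split_def)
  qed (use Dtu in blast)
qed

section \<open>Charts and their inverses\<close>

lemma at_within_openin:
  assumes "openin (top_of_set S) W" "x \<in> W"
  shows "at x within W = at x within S"
proof -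
  obtain O' where "open O'" "W = S \<inter> O'" using assms(1) by (auto simp: openin_open)
  then show ?thesis using assms(2) by (intro at_within_nhd[of x O']) auto
qed

lemma continuous_on_if_continuous_in_charts:
  fixes X :: "real^3 \<Rightarrow> real \<Rightarrow> 'b::topological_space"
  assumes M: "closed_surface k M"
    and X: "\<And>U \<phi>. local_param k M U \<phi> \<Longrightarrow> continuous_on (U \<times> J) (\<lambda>(u, t). X (\<phi> u) t)"
  shows "continuous_on (M \<times> J) (\<lambda>(p, t). X p t)"
  unfolding continuous_on_eq_continuous_within
proof
  fix x assume "x \<in> M \<times> J"
  then obtain p t where x: "x = (p, t)" "p \<in> M" "t \<in> J" by auto
  obtain U \<phi> where U: "local_param k M U \<phi>" "p \<in> \<phi> ` U"
    using M x unfolding closed_surface_def by blast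
  then obtain \<psi> where hom: "homeomorphism U (\<phi> ` U) \<phi> \<psi>" and op: "openin (top_of_set M) (\<phi> ` U)"
    unfolding local_param_def by blast
  have "continuous_on (\<phi> ` U \<times> J) (\<lambda>y. X (\<phi> (\<psi> (fst y))) (snd y))"
  proof (rule continuous_on_compose2[OF X[OF U(1)], of _ "\<lambda>y. (\<psi> (fst y), snd y)", simplified])
    show "continuous_on (\<phi> ` U \<times> J) (\<lambda>y. (\<psi> (fst y), snd y))"
      by (intro continuous_intros continuous_on_compose2[OF homeomorphism_cont2[OF hom]]) auto
    show "(\<lambda>y. (\<psi> (fst y), snd y)) ` (\<phi> ` U \<times> J) \<subseteq> U \<times> J"
      using homeomorphism_apply1[OF hom] by auto
  qed
  then have "continuous_on (\<phi> ` U \<times> J) (\<lambda>(p, t). X p t)"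
    by (rule continuous_on_eq) (use homeomorphism_apply2[OF hom] in force)
  moreover have x': "x \<in> \<phi> ` U \<times> J" using x U by simp
  ultimately have "continuous (at x within \<phi> ` U \<times> J) (\<lambda>(p, t). X p t)"
    unfolding continuous_on_eq_continuous_within by blast
  moreover have "openin (top_of_set (M \<times> J)) (\<phi> ` U \<times> J)"
    using op by (rule openin_Times) simp
  ultimately show "continuous (at x within M \<times> J) (\<lambda>(p, t). X p t)"
    by (simp only: at_within_openin[OF _ x'])
qed

lemma homeomorphism_times_id:
  assumes "homeomorphism U V \<phi> \<psi>"
  shows "homeomorphism (U \<times> J) (V \<times> J) (\<lambda>(u, t). (\<phi> u, t)) (\<lambda>(p, t). (\<psi> p, t))"
proof (rule homeomorphismI)
  show "continuous_on (U \<times> J) (\<lambda>(u, t). (\<phi> u, t))"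
    unfolding split_def
    by (intro continuous_intros continuous_on_compose2[OF homeomorphism_cont1[OF assms]]) auto
  show "continuous_on (V \<times> J) (\<lambda>(p, t). (\<psi> p, t))"
    unfolding split_def
    by (intro continuous_intros continuous_on_compose2[OF homeomorphism_cont2[OF assms]]) auto
qed (use assms in \<open>auto simp: homeomorphism_def\<close>)

text \<open>On a compact set \<open>K\<close> the inverse of \<open>F\<close> is automatically continuous, so that at an
  immersed chart \<open>h\<close> (with inverse \<open>k\<close>) the inverse is even differentiable within the image.
  Within a surface of lower dimension the derivative is not unique. Every left inverse \<open>L\<close> of
  the derivative of \<open>F \<circ> h\<close> serves, and its values on vectors transversal to the image may be
  prescribed; the surface gradient needs an \<open>L\<close> that annihilates the normal.\<close>

lemma chart_inverse_has_derivative: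
  fixes F :: "'k::t2_space \<Rightarrow> 'c::euclidean_space" and h :: "'a::euclidean_space \<Rightarrow> 'k"
  assumes K: "compact K" "continuous_on K F" "inj_on F K"
    and h: "homeomorphism W (h ` W) h k" "openin (top_of_set K) (h ` W)"
    and a: "a \<in> W" and der: "((\<lambda>w. F (h w)) has_derivative D) (at a within W)"
    and L: "linear L" "\<And>v. L (D v) = v"
  shows "((\<lambda>z. k (inv_into K F z)) has_derivative L) (at (F (h a)) within F ` K)"
    and "openin (top_of_set (F ` K)) ((\<lambda>w. F (h w)) ` W)"
proof -
  let ?G = "inv_into K F"
  have hW: "h ` W \<subseteq> K" using h(2) openin_imp_subset by blast
  have cont: "continuous_on (F ` K) ?G"
    by (rule continuous_on_inv) (use K in auto)
  have hom: "homeomorphism K (F ` K) F ?G"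
    by (rule homeomorphismI) (use K cont f_inv_into_f[of _ F K] in \<open>auto intro: inv_into_into\<close>)
  have op: "openin (top_of_set (F ` K)) (F ` (h ` W))"
    by (rule homeomorphism_imp_open_map[OF hom h(2)])
  then show "openin (top_of_set (F ` K)) ((\<lambda>w. F (h w)) ` W)" by (simp add: image_image)
  have LD: "L \<circ> D = id" using L(2) by (simp add: fun_eq_iff)
  have "((\<lambda>z. k (?G z)) has_derivative L) (at (F (h a)) within (\<lambda>w. F (h w)) ` W)"
  proof (rule has_derivative_inverse_within[OF der _ a L(1) LD])
    have "continuous_on ((\<lambda>w. F (h w)) ` W) (\<lambda>z. k (?G z))"
    proof (rule continuous_on_compose2[OF homeomorphism_cont2[OF h(1)]])
      show "continuous_on ((\<lambda>w. F (h w)) ` W) ?G"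
        by (rule continuous_on_subset[OF cont]) (use hW in auto)
      show "?G ` ((\<lambda>w. F (h w)) ` W) \<subseteq> h ` W"
        using hW K(3) by (auto simp: inv_into_f_f)
    qed
    then show "continuous (at (F (h a)) within (\<lambda>w. F (h w)) ` W) (\<lambda>z. k (?G z))"
      using a by (auto simp: continuous_on_eq_continuous_within)
    show "k (?G (F (h w))) = w" if "w \<in> W" for w
      using that hW K(3) homeomorphism_apply1[OF h(1)] by (simp add: inv_into_f_f image_subset_iff)
  qed
  then show "((\<lambda>z. k (?G z)) has_derivative L) (at (F (h a)) within F ` K)"
    using at_within_openin[OF op, of "F (h a)"] a by (simp add: image_image)
qed

section \<open>Tangent space and surface gradient\<close>

lemma derivative_in_tangent_space:
  assumes U: "open U" "u \<in> U" and Y: "\<And>w. w \<in> U \<Longrightarrow> Y differentiable (at w)" "Y ` U \<subseteq> S"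
    and D: "(Y has_derivative D) (at u)"
  shows "D v \<in> tangent_space S (Y u)"
proof -
  let ?line = "\<lambda>s::real. u + s *\<^sub>R v"
  have "open (?line -` U)"
    using U(1) by (intro open_vimage continuous_intros) auto
  moreover have "0 \<in> ?line -` U" using U by simp
  ultimately obtain \<epsilon> where \<epsilon>: "\<epsilon> > 0" "ball 0 \<epsilon> \<subseteq> ?line -` U"
    using openE by blast
  have line: "(?line has_derivative (\<lambda>s. s *\<^sub>R v)) (at s)" for s
    by (auto intro!: derivative_eq_intros)
  have in_U: "?line s \<in> U" if "s \<in> {-\<epsilon><..<\<epsilon>}" for s
    using \<epsilon>(2) that by (auto simp: ball_def subset_iff)
  have "(\<lambda>s. Y (?line s)) differentiable_on {-\<epsilon><..<\<epsilon>}"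
    unfolding differentiable_on_def
  proof
    fix s assume "s \<in> {-\<epsilon><..<\<epsilon>}"
    then obtain D' where "(Y has_derivative D') (at (?line s))"
      using Y(1) in_U unfolding differentiable_def by blast
    from has_derivative_compose[OF line this]
    show "(\<lambda>s. Y (?line s)) differentiable at s within {-\<epsilon><..<\<epsilon>}"
      by (auto simp: differentiable_def intro: has_derivative_at_withinI)
  qed
  moreover have "((\<lambda>s. Y (?line s)) has_vector_derivative D v) (at 0)"
  proof -
    have "(Y has_derivative D) (at (?line 0))" using D by simp
    from has_derivative_compose[OF line this] show ?thesis
      by (simp add: has_vector_derivative_def linear_scale[OF has_derivative_linear[OF D]])
  qed
  moreover have "(\<lambda>s. Y (?line s)) ` {-\<epsilon><..<\<epsilon>} \<subseteq> S" using in_U Y(2) by blast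
  ultimately show ?thesis
    unfolding tangent_space_def mem_Collect_eq using \<epsilon>(1)
    by (intro exI[of _ "\<lambda>s. Y (?line s)"] exI[of _ \<epsilon>]) simp
qed

text \<open>The inclusions \<open>range D \<subseteq> tangent_space S z \<subseteq> (n z)\<^sup>\<bottom>\<close> are both equalities, because the two
  outer subspaces have dimension two.\<close>

lemma tangent_space_eq:
  fixes D :: "real^2 \<Rightarrow> real^3"
  assumes n: "unit_normal_field S n" and z: "z \<in> S"
    and D: "linear D" "inj D" "range D \<subseteq> tangent_space S z"
  shows "tangent_space S z = {\<tau>. n z \<bullet> \<tau> = 0}" and "tangent_space S z = range D"
proof -
  have sub: "tangent_space S z \<subseteq> {\<tau>. n z \<bullet> \<tau> = 0}" and nz: "n z \<noteq> 0"
    using n z unfolding unit_normal_field_def by auto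
  have "dim (range D) = 2"
    using dim_image_eq[OF D(1), of UNIV] D(2) by simp
  moreover have "dim {\<tau>. n z \<bullet> \<tau> = 0} = 2"
    using dim_hyperplane[OF nz] by simp
  ultimately have "range D = {\<tau>. n z \<bullet> \<tau> = 0}"
    using D sub by (intro subspace_dim_equal) (auto simp: subspace_hyperplane linear_subspace_image)
  then show "tangent_space S z = {\<tau>. n z \<bullet> \<tau> = 0}" "tangent_space S z = range D"
    using sub D(3) by auto
qed

text \<open>The characterization of the surface gradient in a chart, which includes that it exists. With
  a left inverse \<open>L\<close> of \<open>D\<close> that annihilates the normal, \<open>f' \<circ> L\<close> is a derivative of \<open>f\<close> within
  the surface, and the vector representing this functional is tangential.\<close>

lemma surface_gradient_eq:
  fixes x :: "real^3 \<Rightarrow> real^3"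
  assumes M: "compact M" and x: "continuous_on M x" "inj_on x M"
    and \<phi>: "local_param k M U \<phi>" "u \<in> U"
    and n: "unit_normal_field (x ` M) n"
    and D: "((\<lambda>u. x (\<phi> u)) has_derivative D) (at u)" "inj D"
      "range D \<subseteq> tangent_space (x ` M) (x (\<phi> u))"
    and f: "((\<lambda>u. f (x (\<phi> u))) has_derivative f') (at u)"
  shows "surface_gradient (x ` M) f (x (\<phi> u)) \<bullet> D v = f' v"
    and "surface_gradient (x ` M) f (x (\<phi> u)) \<bullet> n (x (\<phi> u)) = 0"
proof -
  let ?S = "x ` M" and ?z = "x (\<phi> u)"
  have U: "open U" and op: "openin (top_of_set M) (\<phi> ` U)"
    using \<phi>(1) unfolding local_param_def by auto
  obtain \<psi> where hom: "homeomorphism U (\<phi> ` U) \<phi> \<psi>" using \<phi>(1) unfolding local_param_def by auto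
  have UM: "\<phi> ` U \<subseteq> M" using op openin_imp_subset by blast
  have z: "?z \<in> ?S" using UM \<phi>(2) by auto
  note linD = has_derivative_linear[OF D(1)]
  note tan = tangent_space_eq[OF n z linD D(2,3)]
  obtain L0 where L0: "linear L0" "L0 \<circ> D = id"
    using linear_injective_left_inverse[OF linD D(2)] by blast
  \<comment> \<open>\<open>L0\<close> preceded by the orthogonal projection onto the tangent plane\<close>
  define L where "L h = L0 (h - (n ?z \<bullet> h) *\<^sub>R n ?z)" for h
  have nz: "n ?z \<bullet> n ?z = 1"
    using n z unfolding unit_normal_field_def by (metis norm_eq_1)
  have nD: "n ?z \<bullet> D v = 0" for v using tan by blast
  have linL: "linear L"
    unfolding L_def by (intro linear_compose[OF _ L0(1), unfolded o_def])
      (auto intro!: linearI simp: algebra_simps inner_simps)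
  have LD: "L (D v) = v" for v
    using nD L0(2) by (simp add: L_def fun_eq_iff)
  have Ln: "L (n ?z) = 0"
    using nz linear_0[OF L0(1)] by (simp add: L_def)
  note chart = chart_inverse_has_derivative[OF M x hom op \<phi>(2)
      has_derivative_at_withinI[OF D(1)] linL LD]
  have inv: "\<psi> (inv_into M x (x (\<phi> w))) = w" if "w \<in> U" for w
    using UM that x(2) homeomorphism_apply1[OF hom] by (simp add: inv_into_f_f image_subset_iff)
  have "((\<lambda>z. f (x (\<phi> (\<psi> (inv_into M x z))))) has_derivative (\<lambda>h. f' (L h))) (at ?z within ?S)"
  proof (rule has_derivative_compose[OF chart(1)])
    show "((\<lambda>u. f (x (\<phi> u))) has_derivative f') (at (\<psi> (inv_into M x ?z)))"
      using f inv[OF \<phi>(2)] by simp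
  qed
  then have "((\<lambda>z. f (x (\<phi> (\<psi> (inv_into M x z))))) has_derivative (\<lambda>h. f' (L h)))
      (at ?z within (\<lambda>u. x (\<phi> u)) ` U)"
    by (rule has_derivative_subset) (use UM in auto)
  then have "(f has_derivative (\<lambda>h. f' (L h))) (at ?z within (\<lambda>u. x (\<phi> u)) ` U)"
    by (rule has_derivative_transform[rotated 2]) (use inv \<phi>(2) in auto)
  then have fL: "(f has_derivative (\<lambda>h. f' (L h))) (at ?z within ?S)"
    using at_within_openin[OF chart(2)] \<phi>(2) by auto
  define G where "G = adjoint (\<lambda>h. f' (L h)) 1"
  have G: "G \<bullet> h = f' (L h)" for h
    using adjoint_works[OF has_derivative_linear[OF fL], of h 1]
    by (simp add: G_def inner_commute)
  have GS: "G \<in> tangent_space ?S ?z \<and> (f has_derivative (\<lambda>h. G \<bullet> h)) (at ?z within ?S)"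
  proof
    have "G \<bullet> n ?z = 0"
      using G[of "n ?z"] Ln linear_0[OF has_derivative_linear[OF f]] by simp
    then show "G \<in> tangent_space ?S ?z" using tan(1) by (simp add: inner_commute)
    show "(f has_derivative (\<lambda>h. G \<bullet> h)) (at ?z within ?S)" using fL by (simp only: G)
  qed
  have "surface_gradient ?S f ?z = G"
    unfolding surface_gradient_def
  proof (rule the_equality)
    show "G \<in> tangent_space ?S ?z \<and> (f has_derivative (\<lambda>h. G \<bullet> h)) (at ?z within ?S)"
      by (fact GS)
  next
    fix G' assume G': "G' \<in> tangent_space ?S ?z \<and> (f has_derivative (\<lambda>h. G' \<bullet> h)) (at ?z within ?S)"
    have "((\<lambda>u. f (x (\<phi> u))) has_derivative (\<lambda>v. G' \<bullet> D v)) (at u within U)"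
      by (rule has_derivative_in_compose[OF has_derivative_at_withinI[OF D(1)]])
        (rule has_derivative_subset[OF conjunct2[OF G']], use UM in auto)
    then have "(\<lambda>v. G' \<bullet> D v) = f'"
      using f has_derivative_unique by (metis at_within_open[OF \<phi>(2) U])
    then have "(G' - G) \<bullet> D v = 0" for v
      by (simp add: inner_diff_left G LD fun_eq_iff)
    moreover have "n ?z \<bullet> (G' - G) = 0"
      using G' GS tan(1) by (simp add: inner_diff_right)
    then have "G' - G \<in> range D" using tan by blast
    ultimately have "(G' - G) \<bullet> (G' - G) = 0" by (metis imageE)
    then show "G' = G" by simp
  qed
  then show "surface_gradient ?S f ?z \<bullet> D v = f' v" "surface_gradient ?S f ?z \<bullet> n ?z = 0"
    using G LD Ln linear_0[OF has_derivative_linear[OF f]] by simp_all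
qed

section \<open>Kinematics of an evolving surface\<close>

locale evolving_surface =
  fixes M :: "(real^3) set" and T :: real and X \<nu> :: "real^3 \<Rightarrow> real \<Rightarrow> real^3"
    and S :: "real \<Rightarrow> (real^3) set"
  assumes M: "closed_surface 2 M"
    and T: "0 < T"
    and X_smooth: "Ck_family 2 M T X"
    and X_param: "\<And>t. t \<in> {0..T} \<Longrightarrow> parameterization 2 M (\<lambda>p. X p t) (S t)"
    and normal: "\<And>t. t \<in> {0..T} \<Longrightarrow> unit_normal_field (S t) (\<lambda>z. \<nu> z t)"
begin

abbreviation "velocity \<equiv> time_deriv T X"
abbreviation "acceleration \<equiv> time_deriv T velocity"
abbreviation "speed_sq t z \<equiv> on_surface M X (\<lambda>p t. (norm (velocity p t))\<^sup>2) z t"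

lemma compact_M: "compact M"
  using M by (simp add: closed_surface_def)

lemma S_eq: "t \<in> {0..T} \<Longrightarrow> S t = (\<lambda>p. X p t) ` M"
  and X_inj: "t \<in> {0..T} \<Longrightarrow> inj_on (\<lambda>p. X p t) M"
  using X_param by (auto simp: parameterization_def bij_betw_def)

lemma X_continuous: "continuous_on (M \<times> {0..T}) (\<lambda>(p, t). X p t)"
proof (rule continuous_on_if_continuous_in_charts[OF M])
  fix U \<phi> assume "local_param 2 M U \<phi>"
  then have "Ck_on 2 (U \<times> {0..T}) (\<lambda>(u, t). X (\<phi> u) t)"
    using X_smooth by (simp add: Ck_family_def)
  then have "Ck_on 0 (U \<times> {0..T}) (\<lambda>(u, t). X (\<phi> u) t)"
    unfolding numeral_2_eq_2 by (rule Ck_on_SucD[OF Ck_on_SucD])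
  then show "continuous_on (U \<times> {0..T}) (\<lambda>(u, t). X (\<phi> u) t)" by simp
qed

lemma X_slice_continuous: "t \<in> {0..T} \<Longrightarrow> continuous_on M (\<lambda>p. X p t)"
  by (rule continuous_on_compose2[OF X_continuous, of M "\<lambda>p. (p, t)", simplified])
    (auto intro!: continuous_on_Pair)

lemma on_surface_X:
  assumes "p \<in> M" "t \<in> {0..T}"
  shows "on_surface M X f (X p t) t = f p t"
  using inv_into_f_f[OF X_inj[OF assms(2)] assms(1)] by (simp add: on_surface_def)

lemma chart_around:
  assumes "p \<in> M"
  obtains U \<phi> u where "local_param 2 M U \<phi>" "u \<in> U" "p = \<phi> u"
  using M assms unfolding closed_surface_def by blast

lemma time_deriv_eq:
  assumes "(f p has_vector_derivative d) (at t within {0..T})" "t \<in> {0..T}"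
  shows "time_deriv T f p t = d"
  unfolding time_deriv_def by (rule vector_derivative_within_closed_interval[OF T assms(2,1)])

text \<open>All derivatives of the motion that occur below, in one chart. The time derivatives, which are
  defined by choice, are identified here with partial derivatives.\<close>

lemma chart_partials:
  assumes \<phi>: "local_param 2 M U \<phi>"
  obtains dX dV where
    "\<And>u t. u \<in> U \<Longrightarrow> t \<in> {0..T} \<Longrightarrow> ((\<lambda>(u, t). X (\<phi> u) t) has_derivative
       (\<lambda>(v, r). dX u t v + r *\<^sub>R velocity (\<phi> u) t)) (at (u, t) within U \<times> {0..T})"
    "\<And>u t. u \<in> U \<Longrightarrow> t \<in> {0..T} \<Longrightarrow> ((\<lambda>u. X (\<phi> u) t) has_derivative dX u t) (at u)"
    "\<And>u t. u \<in> U \<Longrightarrow> t \<in> {0..T} \<Longrightarrow> ((\<lambda>u. velocity (\<phi> u) t) has_derivative dV u t) (at u)"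
    "\<And>u t e. u \<in> U \<Longrightarrow> t \<in> {0..T} \<Longrightarrow>
       ((\<lambda>t. dX u t e) has_vector_derivative dV u t e) (at t within {0..T})"
    "\<And>u t. u \<in> U \<Longrightarrow> t \<in> {0..T} \<Longrightarrow> inj (dX u t)"
    "\<And>u t. u \<in> U \<Longrightarrow> t \<in> {0..T} \<Longrightarrow> range (dX u t) \<subseteq> tangent_space (S t) (X (\<phi> u) t)"
    "\<And>u t. u \<in> U \<Longrightarrow> t \<in> {0..T} \<Longrightarrow>
       (X (\<phi> u) has_vector_derivative velocity (\<phi> u) t) (at t within {0..T})"
    "\<And>u t. u \<in> U \<Longrightarrow> t \<in> {0..T} \<Longrightarrow>
       (velocity (\<phi> u) has_vector_derivative acceleration (\<phi> u) t) (at t within {0..T})"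
proof -
  let ?A = "U \<times> {0..T}"
  have U: "open U" and UM: "\<phi> ` U \<subseteq> M"
    using \<phi> openin_imp_subset unfolding local_param_def by blast+
  have "Ck_on 2 ?A (\<lambda>(u, t). X (\<phi> u) t)"
    using X_smooth \<phi> by (simp add: Ck_family_def)
  then obtain dX Yt dV where
    D: "\<And>u t. u \<in> U \<Longrightarrow> t \<in> {0..T} \<Longrightarrow> ((\<lambda>(u, t). X (\<phi> u) t) has_derivative
       (\<lambda>(v, r). dX u t v + r *\<^sub>R Yt u t)) (at (u, t) within ?A)"
    and Yt1: "Ck_on 1 ?A (\<lambda>(u, t). Yt u t)"
    and dV: "\<And>u t. u \<in> U \<Longrightarrow> t \<in> {0..T} \<Longrightarrow> ((\<lambda>u. Yt u t) has_derivative dV u t) (at u)"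
    and dXt: "\<And>u t e. u \<in> U \<Longrightarrow> t \<in> {0..T} \<Longrightarrow>
       ((\<lambda>t. dX u t e) has_vector_derivative dV u t e) (at t within {0..T})"
    using C2_evolution_partials[OF U] by blast
  have Xt: "(X (\<phi> u) has_vector_derivative Yt u t) (at t within {0..T})"
    and dX: "((\<lambda>u. X (\<phi> u) t) has_derivative dX u t) (at u)" if ut: "u \<in> U" "t \<in> {0..T}" for u t
  proof -
    have "dX u t 0 = 0"
      using linear_0[OF has_derivative_linear[OF D[OF ut]]] by (simp add: split_def zero_prod_def)
    then show "(X (\<phi> u) has_vector_derivative Yt u t) (at t within {0..T})"
      using has_derivative_slices(2)[OF D[OF ut] U ut] by simp
    show "((\<lambda>u. X (\<phi> u) t) has_derivative dX u t) (at u)"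
      using has_derivative_slices(1)[OF D[OF ut] U ut] by simp
  qed
  have Yt: "Yt u t = velocity (\<phi> u) t" if "u \<in> U" "t \<in> {0..T}" for u t
    using time_deriv_eq[where f = X, OF Xt[OF that] that(2)] by simp
  have inj_dX: "inj (dX u t)" if ut: "u \<in> U" "t \<in> {0..T}" for u t
  proof -
    have "inj (frechet_derivative ((\<lambda>p. X p t) \<circ> \<phi>) (at u))"
      using X_param[OF ut(2)] \<phi> ut(1) unfolding parameterization_def by blast
    then show ?thesis
      using frechet_derivative_at[OF dX[OF ut]] by (simp add: o_def)
  qed
  have range_dX: "range (dX u t) \<subseteq> tangent_space (S t) (X (\<phi> u) t)"
    if ut: "u \<in> U" "t \<in> {0..T}" for u t
  proof
    fix \<tau> assume "\<tau> \<in> range (dX u t)"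
    then obtain v where v: "\<tau> = dX u t v" by blast
    have "dX u t v \<in> tangent_space (S t) (X (\<phi> u) t)"
    proof (rule derivative_in_tangent_space[OF U ut(1) _ _ dX[OF ut]])
      show "(\<lambda>u. X (\<phi> u) t) differentiable (at w)" if "w \<in> U" for w
        using dX[OF that ut(2)] by (auto simp: differentiable_def)
      show "(\<lambda>u. X (\<phi> u) t) ` U \<subseteq> S t" using UM by (auto simp: S_eq[OF ut(2)])
    qed
    then show "\<tau> \<in> tangent_space (S t) (X (\<phi> u) t)" by (simp only: v)
  qed
  obtain D2 where D2: "\<And>x. x \<in> ?A \<Longrightarrow> ((\<lambda>(u, t). Yt u t) has_derivative D2 x) (at x within ?A)"
    using Yt1 by auto
  have Vt: "(velocity (\<phi> u) has_vector_derivative acceleration (\<phi> u) t) (at t within {0..T})"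
    if ut: "u \<in> U" "t \<in> {0..T}" for u t
  proof -
    have "(Yt u has_vector_derivative D2 (u, t) (0, 1)) (at t within {0..T})"
      by (rule has_derivative_slices(2)[OF D2 U ut]) (use ut in auto)
    then have "(velocity (\<phi> u) has_vector_derivative D2 (u, t) (0, 1)) (at t within {0..T})"
      by (rule has_vector_derivative_transform[rotated 2]) (use ut Yt in auto)
    with time_deriv_eq[where f = velocity, OF this ut(2)] show ?thesis by simp
  qed
  have dV': "((\<lambda>u. velocity (\<phi> u) t) has_derivative dV u t) (at u)"
    if ut: "u \<in> U" "t \<in> {0..T}" for u t
    by (rule has_derivative_transform_within_open[OF dV[OF ut] U ut(1)]) (use Yt ut in auto)
  show ?thesis
  proof (rule that[OF _ dX dV' dXt inj_dX range_dX _ Vt])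
    show "((\<lambda>(u, t). X (\<phi> u) t) has_derivative
       (\<lambda>(v, r). dX u t v + r *\<^sub>R velocity (\<phi> u) t)) (at (u, t) within U \<times> {0..T})"
      if "u \<in> U" "t \<in> {0..T}" for u t
      using D[OF that] Yt[OF that] by simp
    show "(X (\<phi> u) has_vector_derivative velocity (\<phi> u) t) (at t within {0..T})"
      if "u \<in> U" "t \<in> {0..T}" for u t
      using Xt[OF that] Yt[OF that] by simp
  qed
qed

lemma
  assumes "p \<in> M" "t \<in> {0..T}"
  shows X_has_velocity: "(X p has_vector_derivative velocity p t) (at t within {0..T})"
    and velocity_has_acceleration:
      "(velocity p has_vector_derivative acceleration p t) (at t within {0..T})"
    and tangent_space_X: "tangent_space (S t) (X p t) = {\<tau>. \<nu> (X p t) t \<bullet> \<tau> = 0}"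
proof -
  obtain U \<phi> u where \<phi>: "local_param 2 M U \<phi>" and u: "u \<in> U" and p: "p = \<phi> u"
    using chart_around[OF assms(1)] .
  obtain dX where dX: "((\<lambda>u. X (\<phi> u) t) has_derivative dX u t) (at u)" "inj (dX u t)"
      "range (dX u t) \<subseteq> tangent_space (S t) (X (\<phi> u) t)"
    and time: "(X (\<phi> u) has_vector_derivative velocity (\<phi> u) t) (at t within {0..T})"
      "(velocity (\<phi> u) has_vector_derivative acceleration (\<phi> u) t) (at t within {0..T})"
    using chart_partials[OF \<phi>] u assms(2) by metis
  show "(X p has_vector_derivative velocity p t) (at t within {0..T})"
    "(velocity p has_vector_derivative acceleration p t) (at t within {0..T})"
    using time by (simp_all add: p)
  have "X p t \<in> S t" using assms by (simp add: S_eq)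
  then show "tangent_space (S t) (X p t) = {\<tau>. \<nu> (X p t) t \<bullet> \<tau> = 0}"
    using tangent_space_eq(1)[OF normal[OF assms(2)] _ has_derivative_linear[OF dX(1)]] dX(2,3)
    by (simp add: p)
qed

lemma norm_normal: "p \<in> M \<Longrightarrow> t \<in> {0..T} \<Longrightarrow> norm (\<nu> (X p t) t) = 1"
  using normal S_eq by (auto simp: unit_normal_field_def)

text \<open>In a chart the speed is a function of \<open>u\<close>, to which the chain rule applies. The first formula
  makes the gradient term cancel \<open>velocity \<bullet> dV v\<close> in the evolution of the tangential components,
  the second removes it from the normal component.\<close>

lemma surface_gradient_speed_sq:
  assumes \<phi>: "local_param 2 M U \<phi>" "u \<in> U" and t: "t \<in> {0..T}"
    and dX: "((\<lambda>u. X (\<phi> u) t) has_derivative dX) (at u)" "inj dX"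
      "range dX \<subseteq> tangent_space (S t) (X (\<phi> u) t)"
    and dV: "((\<lambda>u. velocity (\<phi> u) t) has_derivative dV) (at u)"
  shows "surface_gradient (S t) (speed_sq t) (X (\<phi> u) t) \<bullet> dX v = 2 * (velocity (\<phi> u) t \<bullet> dV v)"
    and "surface_gradient (S t) (speed_sq t) (X (\<phi> u) t) \<bullet> \<nu> (X (\<phi> u) t) t = 0"
proof -
  have U: "open U" and UM: "\<phi> ` U \<subseteq> M"
    using \<phi> openin_imp_subset unfolding local_param_def by blast+
  have "((\<lambda>u. velocity (\<phi> u) t \<bullet> velocity (\<phi> u) t) has_derivative
      (\<lambda>v. velocity (\<phi> u) t \<bullet> dV v + dV v \<bullet> velocity (\<phi> u) t)) (at u)"
    by (rule has_derivative_inner[OF dV dV])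
  then have "((\<lambda>u. speed_sq t (X (\<phi> u) t)) has_derivative
      (\<lambda>v. velocity (\<phi> u) t \<bullet> dV v + dV v \<bullet> velocity (\<phi> u) t)) (at u)"
  proof (rule has_derivative_transform_within_open[OF _ U \<phi>(2)])
    fix w assume "w \<in> U"
    then have "\<phi> w \<in> M" using UM by blast
    from on_surface_X[OF this t, of "\<lambda>p t. (norm (velocity p t))\<^sup>2"]
    show "velocity (\<phi> w) t \<bullet> velocity (\<phi> w) t = speed_sq t (X (\<phi> w) t)"
      by (simp only: power2_norm_eq_inner)
  qed
  then have der: "((\<lambda>u. speed_sq t (X (\<phi> u) t)) has_derivative
      (\<lambda>v. 2 * (velocity (\<phi> u) t \<bullet> dV v))) (at u)"
    by (simp add: inner_commute)
  note * = surface_gradient_eq[OF compact_M X_slice_continuous[OF t] X_inj[OF t] \<phi>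
      normal[OF t, unfolded S_eq[OF t]] dX(1,2) dX(3)[unfolded S_eq[OF t]] der]
  show "surface_gradient (S t) (speed_sq t) (X (\<phi> u) t) \<bullet> dX v = 2 * (velocity (\<phi> u) t \<bullet> dV v)"
    "surface_gradient (S t) (speed_sq t) (X (\<phi> u) t) \<bullet> \<nu> (X (\<phi> u) t) t = 0"
    using * unfolding S_eq[OF t] by auto
qed

section \<open>Normal parameterizations and normal curves\<close>

text \<open>Along a trajectory each tangential component \<open>velocity \<bullet> dX u t v\<close> has time derivative
  \<open>velocity \<bullet> dV u t v + acceleration \<bullet> dX u t v\<close>; the normal part of the acceleration is
  orthogonal to \<open>dX u t v\<close>, and the gradient part cancels the first summand.\<close>

lemma velocity_normal_if_acceleration:
  assumes acc: "\<And>p t. p \<in> M \<Longrightarrow> t \<in> {0..T} \<Longrightarrow> \<exists>c. acceleration p t =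
      c *\<^sub>R \<nu> (X p t) t - (1/2) *\<^sub>R surface_gradient (S t) (speed_sq t) (X p t)"
    and init: "\<And>p. p \<in> M \<Longrightarrow> \<exists>c. velocity p 0 = c *\<^sub>R \<nu> (X p 0) 0"
    and p: "p \<in> M" and t: "t \<in> {0..T}" and \<tau>: "\<tau> \<in> tangent_space (S t) (X p t)"
  shows "velocity p t \<bullet> \<tau> = 0"
proof -
  obtain U \<phi> u where \<phi>: "local_param 2 M U \<phi>" and u: "u \<in> U" and pu: "p = \<phi> u"
    using chart_around[OF p] .
  obtain dX dV where
    dX: "\<And>t. t \<in> {0..T} \<Longrightarrow> ((\<lambda>u. X (\<phi> u) t) has_derivative dX u t) (at u)"
    and dV: "\<And>t. t \<in> {0..T} \<Longrightarrow> ((\<lambda>u. velocity (\<phi> u) t) has_derivative dV u t) (at u)"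
    and dXt: "\<And>t e. t \<in> {0..T} \<Longrightarrow>
      ((\<lambda>t. dX u t e) has_vector_derivative dV u t e) (at t within {0..T})"
    and inj: "\<And>t. t \<in> {0..T} \<Longrightarrow> inj (dX u t)"
    and tan: "\<And>t. t \<in> {0..T} \<Longrightarrow> range (dX u t) \<subseteq> tangent_space (S t) (X (\<phi> u) t)"
    by (rule chart_partials[OF \<phi>]) (use u in blast)
  have range: "range (dX u t) = tangent_space (S t) (X p t)"
    and \<nu>_dX: "\<nu> (X p t) t \<bullet> dX u t v = 0" if t: "t \<in> {0..T}" for t v
  proof -
    have "X p t \<in> S t" using p t by (simp add: S_eq)
    from tangent_space_eq[OF normal[OF t] this has_derivative_linear[OF dX[OF t]] inj[OF t]] tan[OF t]
    show "range (dX u t) = tangent_space (S t) (X p t)" "\<nu> (X p t) t \<bullet> dX u t v = 0"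
      by (auto simp: pu)
  qed
  obtain v where v: "\<tau> = dX u t v" using \<tau> range[OF t] by blast
  have "((\<lambda>s. velocity p s \<bullet> dX u s v) has_derivative (\<lambda>h. 0)) (at s within {0..T})"
    if s: "s \<in> {0..T}" for s
  proof -
    obtain c where c: "acceleration p s =
        c *\<^sub>R \<nu> (X p s) s - (1/2) *\<^sub>R surface_gradient (S s) (speed_sq s) (X p s)"
      using acc[OF p s] by blast
    have "surface_gradient (S s) (speed_sq s) (X p s) \<bullet> dX u s v = 2 * (velocity p s \<bullet> dV u s v)"
      using surface_gradient_speed_sq(1)[OF \<phi> u s dX[OF s] inj[OF s] tan[OF s] dV[OF s]]
      by (simp add: pu)
    then have zero: "velocity p s \<bullet> dV u s v + acceleration p s \<bullet> dX u s v = 0"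
      by (simp add: c inner_diff_left \<nu>_dX[OF s])
    have "((\<lambda>s. velocity p s \<bullet> dX u s v) has_vector_derivative
        velocity p s \<bullet> dV u s v + acceleration p s \<bullet> dX u s v) (at s within {0..T})"
      by (rule bounded_bilinear.has_vector_derivative[OF bounded_bilinear_inner
            velocity_has_acceleration[OF p s] dXt[OF s]])
    then show ?thesis by (simp add: zero has_vector_derivative_def)
  qed
  then have "velocity p t \<bullet> dX u t v = velocity p 0 \<bullet> dX u 0 v"
    using T t by (intro has_derivative_zero_unique[of "{0..T}" "\<lambda>s. velocity p s \<bullet> dX u s v"]) auto
  also have "\<dots> = 0"
    using init[OF p] \<nu>_dX[of 0 v] T by auto
  finally show ?thesis by (simp add: v)
qed

lemma velocity_eq_normal_component:
  assumes "\<And>\<tau>. \<tau> \<in> tangent_space (S t) (X p t) \<Longrightarrow> velocity p t \<bullet> \<tau> = 0"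
    and p: "p \<in> M" and t: "t \<in> {0..T}"
  shows "velocity p t = (velocity p t \<bullet> \<nu> (X p t) t) *\<^sub>R \<nu> (X p t) t"
proof -
  let ?n = "\<nu> (X p t) t" and ?V = "velocity p t"
  let ?w = "?V - (?V \<bullet> ?n) *\<^sub>R ?n"
  have n: "?n \<bullet> ?n = 1" using norm_normal[OF p t] by (simp add: norm_eq_1)
  have nw: "?n \<bullet> ?w = 0" by (simp add: inner_diff_right n inner_commute)
  then have "?V \<bullet> ?w = 0" using assms(1) tangent_space_X[OF p t] by blast
  then have "?w \<bullet> ?w = 0" using nw by (simp add: inner_diff_left)
  then show ?thesis by simp
qed

text \<open>A normal curve solves a differential equation whose right-hand side lives on the moving
  surface only. To see that it follows one particle, let \<open>q s \<in> M\<close> be the label of the particle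
  at \<open>\<gamma> s\<close>. The space-time curve \<open>s \<mapsto> (\<gamma> s, s)\<close> has at time \<open>s\<close> the same velocity as the
  trajectory of \<open>q s\<close>, because \<open>X\<close> moves all particles in normal direction. The derivative of the
  inverse of the space-time map sends this velocity to the pure time direction, so \<open>q\<close> has
  derivative zero.\<close>

lemma normal_curve_is_trajectory:
  assumes nor: "\<And>p t. p \<in> M \<Longrightarrow> t \<in> {0..T} \<Longrightarrow>
      velocity p t = (velocity p t \<bullet> \<nu> (X p t) t) *\<^sub>R \<nu> (X p t) t"
    and \<gamma>: "normal_curve T S (normal_velocity M T X \<nu>) \<nu> (X p t0) t0 \<gamma>"
    and p: "p \<in> M" and t0: "t0 \<in> {0..T}" and t: "t \<in> {0..T}"
  shows "\<gamma> t = X p t"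
proof -
  let ?K = "M \<times> {0..T}"
  define F where "F = (\<lambda>(p, t). (X p t, t))"
  define q where "q s = inv_into M (\<lambda>p. X p s) (\<gamma> s)" for s
  have K: "compact ?K" using compact_M by (rule compact_Times) simp
  have contF: "continuous_on ?K F"
    using X_continuous by (auto simp: F_def split_def intro!: continuous_on_Pair continuous_intros)
  have injF: "inj_on F ?K"
    using X_inj by (auto simp: F_def inj_on_def)
  have \<gamma>S: "\<gamma> s \<in> (\<lambda>p. X p s) ` M" if "s \<in> {0..T}" for s
    using \<gamma> that unfolding normal_curve_def S_eq[OF that, symmetric] by blast
  have q: "q s \<in> M" "X (q s) s = \<gamma> s" if "s \<in> {0..T}" for s
    unfolding q_def using inv_into_into[OF \<gamma>S[OF that]] f_inv_into_f[OF \<gamma>S[OF that]] by auto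
  have invF: "inv_into ?K F (\<gamma> s, s) = (q s, s)" if s: "s \<in> {0..T}" for s
  proof -
    have "F (q s, s) = (\<gamma> s, s)" using q[OF s] by (simp add: F_def)
    moreover have "(q s, s) \<in> ?K" using q[OF s] s by simp
    ultimately show ?thesis using inv_into_f_f[OF injF] by metis
  qed
  have \<gamma>_vel: "(\<gamma> has_vector_derivative velocity (q s) s) (at s within {0..T})" if s: "s \<in> {0..T}" for s
  proof -
    have "normal_velocity M T X \<nu> (\<gamma> s) s *\<^sub>R \<nu> (\<gamma> s) s = velocity (q s) s"
      using nor[OF q(1)[OF s] s] on_surface_X[OF q(1)[OF s] s, of velocity] q(2)[OF s]
      by (simp add: normal_velocity_def)
    then show ?thesis using \<gamma> s unfolding normal_curve_def by metis
  qed
  have \<gamma>F: "(\<gamma> s, s) \<in> F ` ?K" if s: "s \<in> {0..T}" for s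
  proof (rule image_eqI)
    show "(\<gamma> s, s) = F (q s, s)" using q(2)[OF s] by (simp add: F_def)
    show "(q s, s) \<in> ?K" using q(1)[OF s] s by simp
  qed
  have cont_q: "continuous_on {0..T} q"
  proof -
    have "continuous_on {0..T} \<gamma>"
      using \<gamma>_vel by (meson has_vector_derivative_continuous continuous_on_eq_continuous_within)
    then have pair: "continuous_on {0..T} (\<lambda>s. (\<gamma> s, s))"
      by (intro continuous_on_Pair continuous_on_id)
    have "continuous_on (F ` ?K) (inv_into ?K F)"
      by (rule continuous_on_inv[OF contF K]) (use injF in auto)
    then have "continuous_on {0..T} (\<lambda>s. inv_into ?K F (\<gamma> s, s))"
      by (rule continuous_on_compose2[OF _ pair]) (use \<gamma>F in blast)
    then have "continuous_on {0..T} (\<lambda>s. fst (inv_into ?K F (\<gamma> s, s)))"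
      by (rule continuous_on_fst)
    then show ?thesis by (rule continuous_on_eq) (simp add: invF)
  qed
  have "(q has_derivative (\<lambda>h. 0)) (at s within {0..T})" if s: "s \<in> {0..T}" for s
  proof -
    obtain U \<phi> u where \<phi>: "local_param 2 M U \<phi>" and u: "u \<in> U" and qu: "q s = \<phi> u"
      using chart_around[OF q(1)[OF s]] .
    obtain dX where dX: "((\<lambda>(u, t). X (\<phi> u) t) has_derivative
        (\<lambda>(v, r). dX u s v + r *\<^sub>R velocity (\<phi> u) s)) (at (u, s) within U \<times> {0..T})"
      and inj: "inj (dX u s)" and lin: "linear (dX u s)"
      using chart_partials[OF \<phi>] u s has_derivative_linear by metis
    obtain \<psi> where hom: "homeomorphism U (\<phi> ` U) \<phi> \<psi>" and op: "openin (top_of_set M) (\<phi> ` U)"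
      and Ck: "Ck_on (Suc (Suc 0)) U \<phi>" and U: "open U"
      using \<phi> unfolding local_param_def numeral_2_eq_2 by blast
    let ?W = "U \<times> {0..T}" and ?h = "\<lambda>(u, t). (\<phi> u, t)" and ?k = "\<lambda>(p, t). (\<psi> p, t)"
    let ?V = "velocity (\<phi> u) s"
    have hW: "?h ` ?W = \<phi> ` U \<times> {0..T}" by auto
    obtain L where L: "linear L" "L \<circ> dX u s = id"
      using linear_injective_left_inverse[OF lin inj] by blast
    have LdX: "L (dX u s v) = v" for v using L(2) by (metis comp_apply id_apply)
    \<comment> \<open>a left inverse of the derivative \<open>(v, r) \<mapsto> (dX v + r V, r)\<close> of the space-time map\<close>
    have L': "linear (\<lambda>(z, r::real). (L (z - r *\<^sub>R ?V), r))"
      using L(1) by (intro linearI) (auto simp: linear_add linear_diff linear_scale algebra_simps)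
    have der: "((\<lambda>w. F (?h w)) has_derivative (\<lambda>(v, r). (dX u s v + r *\<^sub>R ?V, r))) (at (u, s) within ?W)"
      using has_derivative_Pair[OF dX has_derivative_snd[OF has_derivative_ident]]
      by (simp add: F_def split_def)
    have us: "(u, s) \<in> ?W" using u s by simp
    have "((\<lambda>z. ?k (inv_into ?K F z)) has_derivative (\<lambda>(z, r). (L (z - r *\<^sub>R ?V), r)))
        (at (F (?h (u, s))) within F ` ?K)"
      by (rule chart_inverse_has_derivative(1)[OF K contF injF _ _ us der L'])
        (use homeomorphism_times_id[OF hom, of "{0..T}"] openin_Times[OF op openin_subtopology_self] LdX
          in \<open>auto simp: hW\<close>)
    moreover have "F (?h (u, s)) = (\<gamma> s, s)" using q(2)[OF s] by (simp add: F_def qu)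
    ultimately have "((\<lambda>z. ?k (inv_into ?K F z)) has_derivative (\<lambda>(z, r). (L (z - r *\<^sub>R ?V), r)))
        (at (\<gamma> s, s) within (\<lambda>s. (\<gamma> s, s)) ` {0..T})"
      using \<gamma>F by (auto intro: has_derivative_subset)
    moreover have "((\<lambda>s. (\<gamma> s, s)) has_derivative (\<lambda>h. (h *\<^sub>R ?V, h))) (at s within {0..T})"
      using \<gamma>_vel[OF s] by (intro has_derivative_Pair has_derivative_ident)
        (simp add: has_vector_derivative_def qu)
    ultimately have "((\<lambda>s. ?k (inv_into ?K F (\<gamma> s, s))) has_derivative
        (\<lambda>h. (L (h *\<^sub>R ?V - h *\<^sub>R ?V), h))) (at s within {0..T})"
      using has_derivative_in_compose by fastforce
    then have "((\<lambda>s. fst (?k (inv_into ?K F (\<gamma> s, s)))) has_derivative (\<lambda>h. 0)) (at s within {0..T})"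
      using has_derivative_fst linear_0[OF L(1)] by force
    then have \<psi>q: "((\<lambda>s. \<psi> (q s)) has_derivative (\<lambda>h. 0)) (at s within {0..T})"
      by (rule has_derivative_transform[OF s, rotated]) (simp add: invF)
    have \<psi>u: "\<psi> (q s) = u" using homeomorphism_apply1[OF hom u] by (simp add: qu)
    obtain \<phi>' where \<phi>': "(\<phi> has_derivative \<phi>') (at u)"
      using Ck u at_within_open[OF u U] unfolding Ck_on.simps(2)[of "Suc 0"] by metis
    have "((\<lambda>s. \<phi> (\<psi> (q s))) has_derivative (\<lambda>h. \<phi>' 0)) (at s within {0..T})"
      by (rule has_derivative_compose[OF \<psi>q]) (simp add: \<psi>u \<phi>')
    then have \<phi>\<psi>q: "((\<lambda>s. \<phi> (\<psi> (q s))) has_derivative (\<lambda>h. 0)) (at s within {0..T})"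
      by (simp add: linear_0[OF has_derivative_linear[OF \<phi>']])
    \<comment> \<open>\<open>\<phi> \<circ> \<psi>\<close> is the identity only on the chart, in which \<open>q\<close> stays near \<open>s\<close> by continuity\<close>
    let ?I = "{0..T} \<inter> q -` (\<phi> ` U)"
    have sI: "s \<in> ?I" using s u by (simp add: qu)
    have opI: "openin (top_of_set {0..T}) ?I"
      by (rule continuous_openin_preimage[OF cont_q _ op]) (use q in auto)
    have "((\<lambda>s. \<phi> (\<psi> (q s))) has_derivative (\<lambda>h. 0)) (at s within ?I)"
      using \<phi>\<psi>q by (rule has_derivative_subset) auto
    then have "(q has_derivative (\<lambda>h. 0)) (at s within ?I)"
      by (rule has_derivative_transform[OF sI, rotated]) (use homeomorphism_apply2[OF hom] in auto)
    then show ?thesis by (simp only: at_within_openin[OF opI sI])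
  qed
  then have "q t = q t0"
    using t t0 by (intro has_derivative_zero_unique[of "{0..T}" q]) auto
  moreover have "q t0 = p"
    using \<gamma> inv_into_f_f[OF X_inj[OF t0] p] by (simp add: q_def normal_curve_def)
  ultimately show ?thesis using q(2)[OF t] by simp
qed

lemma trajectory_is_normal_curve:
  assumes nor: "\<And>t. t \<in> {0..T} \<Longrightarrow>
      velocity p t = (velocity p t \<bullet> \<nu> (X p t) t) *\<^sub>R \<nu> (X p t) t"
    and p: "p \<in> M"
  shows "normal_curve T S (normal_velocity M T X \<nu>) \<nu> (X p t0) t0 (X p)"
  unfolding normal_curve_def
proof (intro conjI ballI)
  fix t assume t: "t \<in> {0..T}"
  show "X p t \<in> S t" using p t by (simp add: S_eq)
  have "normal_velocity M T X \<nu> (X p t) t *\<^sub>R \<nu> (X p t) t = velocity p t"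
    using nor[OF t] on_surface_X[OF p t, of velocity] by (simp add: normal_velocity_def)
  with X_has_velocity[OF p t]
  show "(X p has_vector_derivative normal_velocity M T X \<nu> (X p t) t *\<^sub>R \<nu> (X p t) t)
      (at t within {0..T})" by simp
qed simp

lemma normal_derivative:
  assumes "Ck_family 1 M T (\<lambda>p t. \<nu> (X p t) t)" and p: "p \<in> M" and t: "t \<in> {0..T}"
  obtains n' where "((\<lambda>t. \<nu> (X p t) t) has_vector_derivative n') (at t within {0..T})"
    "\<nu> (X p t) t \<bullet> n' = 0"
proof -
  obtain U \<phi> u where \<phi>: "local_param 2 M U \<phi>" and u: "u \<in> U" and pu: "p = \<phi> u"
    using chart_around[OF p] .
  have U: "open U" using \<phi> by (simp add: local_param_def)
  have "local_param 1 M U \<phi>"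
    using local_param_SucD[of 1 M U \<phi>] \<phi> by (simp add: numeral_2_eq_2)
  then have "Ck_on (Suc 0) (U \<times> {0..T}) (\<lambda>(u, t). \<nu> (X (\<phi> u) t) t)"
    using assms(1) by (simp add: Ck_family_def)
  then obtain D where "((\<lambda>(u, t). \<nu> (X (\<phi> u) t) t) has_derivative D) (at (u, t) within U \<times> {0..T})"
    unfolding Ck_on.simps using u t by blast
  from has_derivative_slices(2)[OF this U u t]
  have n': "((\<lambda>t. \<nu> (X p t) t) has_vector_derivative D (0, 1)) (at t within {0..T})"
    by (simp add: pu)
  have "((\<lambda>t. \<nu> (X p t) t \<bullet> \<nu> (X p t) t) has_vector_derivative
      \<nu> (X p t) t \<bullet> D (0, 1) + D (0, 1) \<bullet> \<nu> (X p t) t) (at t within {0..T})"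
    by (rule bounded_bilinear.has_vector_derivative[OF bounded_bilinear_inner n' n'])
  moreover have "((\<lambda>t. \<nu> (X p t) t \<bullet> \<nu> (X p t) t) has_vector_derivative 0) (at t within {0..T})"
    by (rule has_vector_derivative_transform[OF t _ has_vector_derivative_const[of 1]])
      (use norm_normal[OF p] in \<open>simp add: norm_eq_1\<close>)
  ultimately have "\<nu> (X p t) t \<bullet> D (0, 1) + D (0, 1) \<bullet> \<nu> (X p t) t = 0"
    using T t by (intro vector_derivative_unique_within_closed_interval[of 0 T t]) auto
  then have "\<nu> (X p t) t \<bullet> D (0, 1) = 0" by (simp add: inner_commute)
  with n' show ?thesis by (rule that)
qed

end

section \<open>The equation for the normal velocity\<close>

theorem lemma2p1:
  fixes g :: "real \<Rightarrow> real"
    and M S\<^sub>0 :: "(real^3) set"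
    and T :: real
    and X \<nu> :: "real^3 \<Rightarrow> real \<Rightarrow> real^3"
    and S :: "real \<Rightarrow> (real^3) set"
    and X\<^sub>0 :: "real^3 \<Rightarrow> real^3"
    and V\<^sub>0 :: "real^3 \<Rightarrow> real"
  assumes g: "continuous_on {0..} g"
    and M: "closed_surface 2 M"
    and T: "0 < T"
    and X_smooth: "Ck_family 2 M T X"
    and X_param: "\<And>t. t \<in> {0..T} \<Longrightarrow> parameterization 2 M (\<lambda>p. X p t) (S t)"
    and normal: "\<And>t. t \<in> {0..T} \<Longrightarrow> unit_normal_field (S t) (\<lambda>z. \<nu> z t)"
    and normal_smooth: "Ck_family 1 M T (\<lambda>p t. \<nu> (X p t) t)"
    and evolution: "\<And>t z. t \<in> {0..T} \<Longrightarrow> z \<in> S t \<Longrightarrow>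
      on_surface M X (time_deriv T (time_deriv T X)) z t =
        (g (on_surface M X (\<lambda>p t. (norm (time_deriv T X p t))\<^sup>2) z t) *
           mean_curvature (S t) (\<lambda>z. \<nu> z t) z) *\<^sub>R \<nu> z t
        - (1/2) *\<^sub>R surface_gradient (S t)
            (\<lambda>z. on_surface M X (\<lambda>p t. (norm (time_deriv T X p t))\<^sup>2) z t) z"
    and X0_param: "parameterization 2 M X\<^sub>0 S\<^sub>0"
    and initial_position: "\<And>p. p \<in> M \<Longrightarrow> X p 0 = X\<^sub>0 p"
    and initial_velocity: "\<And>p. p \<in> M \<Longrightarrow> time_deriv T X p 0 = V\<^sub>0 p *\<^sub>R \<nu> (X\<^sub>0 p) 0"
  shows "(\<forall>t\<in>{0..T}. \<forall>z\<in>S t.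
      has_normal_time_derivative T S (normal_velocity M T X \<nu>) \<nu> (normal_velocity M T X \<nu>)
        (g ((normal_velocity M T X \<nu> z t)\<^sup>2) * mean_curvature (S t) (\<lambda>z. \<nu> z t) z) z t) \<and>
    (\<forall>p\<in>M. \<forall>t\<in>{0..T}. \<forall>\<tau>\<in>tangent_space (S t) (X p t). time_deriv T X p t \<bullet> \<tau> = 0)"
proof -
  interpret evolving_surface M T X \<nu> S
    by unfold_locales (fact M T X_smooth X_param normal)+
  have acc: "acceleration p t = (g ((norm (velocity p t))\<^sup>2) *
        mean_curvature (S t) (\<lambda>z. \<nu> z t) (X p t)) *\<^sub>R \<nu> (X p t) t
      - (1/2) *\<^sub>R surface_gradient (S t) (speed_sq t) (X p t)" if p: "p \<in> M" and t: "t \<in> {0..T}" for p t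
  proof -
    have "X p t \<in> S t" using p by (simp add: S_eq[OF t])
    from evolution[OF t this] show ?thesis by (simp only: on_surface_X[OF p t])
  qed
  have perp: "velocity p t \<bullet> \<tau> = 0"
    if "p \<in> M" "t \<in> {0..T}" "\<tau> \<in> tangent_space (S t) (X p t)" for p t \<tau>
  proof (rule velocity_normal_if_acceleration[OF _ _ that])
    fix p assume p: "p \<in> M"
    show "\<exists>c. velocity p 0 = c *\<^sub>R \<nu> (X p 0) 0"
      using initial_velocity[OF p] initial_position[OF p] by auto
    show "\<exists>c. acceleration p t =
        c *\<^sub>R \<nu> (X p t) t - (1/2) *\<^sub>R surface_gradient (S t) (speed_sq t) (X p t)"
      if "t \<in> {0..T}" for t
      using acc[OF p that] by blast
  qed
  have V_eq: "velocity p t = (velocity p t \<bullet> \<nu> (X p t) t) *\<^sub>R \<nu> (X p t) t"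
    if "p \<in> M" "t \<in> {0..T}" for p t
    using velocity_eq_normal_component[OF perp that] that by blast
  have "has_normal_time_derivative T S (normal_velocity M T X \<nu>) \<nu> (normal_velocity M T X \<nu>)
      (g ((normal_velocity M T X \<nu> z t)\<^sup>2) * mean_curvature (S t) (\<lambda>z. \<nu> z t) z) z t"
    if t: "t \<in> {0..T}" and z: "z \<in> S t" for t z
  proof -
    obtain p where p: "p \<in> M" and zp: "z = X p t" using z S_eq[OF t] by auto
    let ?v = "normal_velocity M T X \<nu>" and ?n = "\<nu> (X p t) t"
    have v_X: "?v (X p s) s = velocity p s \<bullet> \<nu> (X p s) s" if "s \<in> {0..T}" for s
      using on_surface_X[OF p that, of velocity] by (simp add: normal_velocity_def)
    have nn: "?n \<bullet> ?n = 1" using norm_normal[OF p t] by (simp add: norm_eq_1)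
    have "velocity p t = ?v (X p t) t *\<^sub>R ?n" using V_eq[OF p t] v_X[OF t] by simp
    then have speed: "(norm (velocity p t))\<^sup>2 = (?v z t)\<^sup>2"
      using norm_normal[OF p t] by (simp add: zp)
    obtain U \<phi> u where \<phi>: "local_param 2 M U \<phi>" "u \<in> U" and pu: "p = \<phi> u"
      using chart_around[OF p] .
    have grad: "surface_gradient (S t) (speed_sq t) (X p t) \<bullet> ?n = 0"
      using surface_gradient_speed_sq(2)[OF \<phi> t] chart_partials[OF \<phi>(1)] \<phi>(2) t pu by metis
    obtain n' where n': "((\<lambda>t. \<nu> (X p t) t) has_vector_derivative n') (at t within {0..T})"
      "?n \<bullet> n' = 0"
      using normal_derivative[OF normal_smooth p t] .
    have "velocity p t \<bullet> n' + acceleration p t \<bullet> ?n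
        = g ((?v z t)\<^sup>2) * mean_curvature (S t) (\<lambda>z. \<nu> z t) z"
    proof -
      have "velocity p t \<bullet> n' = 0" using V_eq[OF p t] n'(2) by (metis inner_scaleR_left mult_zero_right)
      then show ?thesis
        unfolding acc[OF p t] by (simp add: inner_diff_left nn grad speed zp)
    qed
    moreover have "((\<lambda>s. velocity p s \<bullet> \<nu> (X p s) s) has_vector_derivative
        velocity p t \<bullet> n' + acceleration p t \<bullet> ?n) (at t within {0..T})"
      by (rule bounded_bilinear.has_vector_derivative[OF bounded_bilinear_inner
            velocity_has_acceleration[OF p t] n'(1)])
    ultimately have der: "((\<lambda>s. velocity p s \<bullet> \<nu> (X p s) s) has_vector_derivative
        g ((?v z t)\<^sup>2) * mean_curvature (S t) (\<lambda>z. \<nu> z t) z) (at t within {0..T})"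
      by simp
    show ?thesis
      unfolding has_normal_time_derivative_def
    proof (intro conjI exI allI impI)
      show "normal_curve T S ?v \<nu> z t (X p)"
        unfolding zp by (rule trajectory_is_normal_curve) (use V_eq p in auto)
      fix \<gamma> assume "normal_curve T S ?v \<nu> z t \<gamma>"
      then have \<gamma>: "\<gamma> s = X p s" if "s \<in> {0..T}" for s
        using normal_curve_is_trajectory[OF V_eq _ p t that] by (simp add: zp)
      show "((\<lambda>s. ?v (\<gamma> s) s) has_real_derivative
          g ((?v z t)\<^sup>2) * mean_curvature (S t) (\<lambda>z. \<nu> z t) z) (at t within {0..T})"
        unfolding has_real_derivative_iff_has_vector_derivative
        by (rule has_vector_derivative_transform[OF t _ der]) (simp add: \<gamma> v_X)
    qed
  qed
  with perp show ?thesis by blast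
qed

end
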